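(* Let $F_k:\mathbb{R}^n\to\mathcal{I}$ be $\preccurlyeq_{CW}$-lsc for all $k=1,\dots,m$, and let $g_j:\mathbb{R}^n\to\mathbb{R}$ be lower semicontinuous on $\mathbb{R}^n$ for all $j=1,\dots,p$. Let $F=(F_1,\dots,F_m)$ and $S:=\{u\in\mathbb{R}^n: g_j(u)\le 0,\ j=1,\dots,p\}$. Then for every $\varepsilon=(\varepsilon_1,\dots,\varepsilon_m)\in\mathbb{R}^m_+\setminus\{0\}$ one has $QM(F,S,\varepsilon')\neq\emptyset$, where $\varepsilon':=(\sqrt{\varepsilon_1},\dots,\sqrt{\varepsilon_m})$.
   Context: $\mathcal{I}$ is the set of all compact intervals $[\underline q,\overline q]$ with $\underline q\le\overline q$ real. For $Q=[\underline q,\overline q]\in\mathcal I$ put $q^c=\frac{\underline q+\overline q}{2}$ and $q^w=\frac{\overline q-\underline q}{2}$. Addition: $[\underline q,\overline q]+[\underline r,\overline r]=[\underline q+\underline r,\overline q+\overline r]$. Order: for $Q=[\underline q,\overline q]$ and $R=[\underline r,\overline r]$ in $\mathcal I$, $Q\prec_{CW}R$ iff $q^c<r^c$ and $q^w<r^w$. $\mathbb{R}^m_+$ is the nonnegative orthant of $\mathbb{R}^m$; $\|\cdot\|$ is the norm on $\mathbb{R}^n$. For $f=[\underline f,\overline f]:\mathbb{R}^n\to\mathcal I$ write $f^c=\frac{\underline f+\overline f}{2}$, $f^w=\frac{\overline f-\underline f}{2}$; $f$ is $\preccurlyeq_{CW}$-lsc if $f^c$ and $f^w$ are both lower semicontinuous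 on $\mathbb{R}^n$. For $\eta=(\eta_1,\dots,\eta_m)\in\mathbb{R}^m_+$, $QM(F,S,\eta)$ (the set of weak $\eta$-quasi-minimal solutions of the problem of minimizing $F$ over $S$) is the set of all $z_0\in S$ for which there is no $z\in S$ with $F_k(z)+[0,\eta_k\|z-z_0\|]\prec_{CW}F_k(z_0)$ for all $k=1,\dots,m$.
   Formalization: The feasible set S is additionally assumed to be nonempty; without this the claim fails, e.g. for p = 1 and g_1 identically 1, where S and hence QM(F,S,ε') is empty. *)

theory Defs
  imports "HOL-Analysis.Analysis" "HOL-Library.Interval"
begin

definition center :: "real interval \<Rightarrow> real" where
  "center Q = (lower Q + upper Q) / 2"

text \<open>The library constant \<^const>\<open>width\<close> is the full length of the interval,
  twice the quantity needed here.\<close>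

definition half_width :: "real interval \<Rightarrow> real" where
  "half_width Q = (upper Q - lower Q) / 2"

definition cw_less :: "real interval \<Rightarrow> real interval \<Rightarrow> bool" (infix \<open>\<prec>\<^bsub>CW\<^esub>\<close> 50) where
  "Q \<prec>\<^bsub>CW\<^esub> R \<longleftrightarrow> center Q < center R \<and> half_width Q < half_width R"

definition lower_semicontinuous :: "('a::topological_space \<Rightarrow> real) \<Rightarrow> bool" where
  "lower_semicontinuous f \<longleftrightarrow> (\<forall>x. \<forall>c < f x. \<forall>\<^sub>F y in nhds x. c < f y)"

definition cw_lsc :: "('a::topological_space \<Rightarrow> real interval) \<Rightarrow> bool" where
  "cw_lsc f \<longleftrightarrow>
     lower_semicontinuous (\<lambda>x. center (f x)) \<and> lower_semicontinuous (\<lambda>x. half_width (f x))"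

definition feasible_set :: "nat \<Rightarrow> (nat \<Rightarrow> real ^ 'n \<Rightarrow> real) \<Rightarrow> (real ^ 'n) set" where
  "feasible_set p g = {u. \<forall>j \<in> {1..p}. g j u \<le> 0}"

text \<open>Weak \<open>\<eta>\<close>-quasi-minimal solutions, intended for \<open>\<eta>\<close> with nonnegative components. Then
  \<open>Ivl 0 (\<eta> $ k * norm (z - z0))\<close> really is the interval with these two endpoints
  (in general, \<open>Ivl a b\<close> has lower endpoint \<open>min a b\<close>).\<close>

definition QM ::
  "('m \<Rightarrow> real ^ 'n \<Rightarrow> real interval) \<Rightarrow> (real ^ 'n) set \<Rightarrow> real ^ 'm \<Rightarrow> (real ^ 'n) set" where
  "QM F S \<eta> =
     {z0 \<in> S. \<not> (\<exists>z \<in> S. \<forall>k. F k z + Ivl 0 (\<eta> $ k * norm (z - z0)) \<prec>\<^bsub>CW\<^esub> F k z0)}"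

end

theory Submission
  imports Defs
begin

text \<open>Comparing half-widths in a component \<open>k\<close> with \<open>\<epsilon> $ k > 0\<close> is enough: half-widths are
  nonnegative, so a weak form of Ekeland's variational principle applies. In finite dimension it is
  obtained by minimizing the coercive function \<open>\<lambda>x. h x + c * dist x a\<close> over the closed feasible
  set; by the triangle inequality a minimizer \<open>z0\<close> satisfies \<open>h z0 \<le> h z + c * dist z z0\<close>.\<close>

lemma open_superlevel_lower_semicontinuous:
  assumes "lower_semicontinuous f"
  shows "open {x. c < f x}"
  unfolding open_subopen[of "{x. c < f x}"]
  using assms by (fastforce simp: lower_semicontinuous_def eventually_nhds)

lemma closed_sublevel_lower_semicontinuous:
  assumes "lower_semicontinuous f"
  shows "closed {x. f x \<le> c}"
proof -
  have "- {x. f x \<le> c} = {x. c < f x}"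
    by auto
  then show ?thesis
    using open_superlevel_lower_semicontinuous[OF assms] by (metis closed_def)
qed

lemma lower_semicontinuous_add:
  assumes "lower_semicontinuous f" "lower_semicontinuous g"
  shows "lower_semicontinuous (\<lambda>x. f x + g x)"
  unfolding lower_semicontinuous_def
proof (intro allI impI)
  fix x c
  assume c: "c < f x + g x"
  \<comment> \<open>Half of the slack: the two lower bounds \<open>f x - d\<close> and
    \<open>g x - d\<close> add up to exactly \<open>c\<close>.\<close>
  define d where "d = (f x + g x - c) / 2"
  have "f x - d < f x" "g x - d < g x"
    using c by (auto simp: d_def)
  then have "\<forall>\<^sub>F y in nhds x. f x - d < f y" "\<forall>\<^sub>F y in nhds x. g x - d < g y"
    using assms unfolding lower_semicontinuous_def by blast+
  then show "\<forall>\<^sub>F y in nhds x. c < f y + g y"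
    by eventually_elim (auto simp: d_def field_simps)
qed

lemma continuous_imp_lower_semicontinuous:
  assumes "continuous_on UNIV f"
  shows "lower_semicontinuous f"
  unfolding lower_semicontinuous_def
proof (intro allI impI)
  fix x c
  assume "c < f x"
  moreover have "open {y. c < f y}"
    using assms by (intro open_Collect_less continuous_intros)
  ultimately show "\<forall>\<^sub>F y in nhds x. c < f y"
    unfolding eventually_nhds by blast
qed

text \<open>Without a minimizer, every point of \<open>K\<close> lies in one of the open sets
  \<open>{x. f y < f x}\<close> with \<open>y\<close> in \<open>K\<close>. Compactness then leaves
  only finitely many values \<open>f y\<close> to compare.\<close>

lemma lower_semicontinuous_attains_inf:
  assumes f: "lower_semicontinuous f" and K: "compact K" "K \<noteq> {}"
  obtains x where "x \<in> K" "\<And>y. y \<in> K \<Longrightarrow> f x \<le> f y"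
proof (rule ccontr)
  assume "\<not> thesis"
  then have "K \<subseteq> (\<Union>y\<in>K. {x. f y < f x})"
    using that by (simp add: subset_iff) (meson not_le)
  then obtain D where D: "D \<subseteq> K" "finite D" "K \<subseteq> (\<Union>y\<in>D. {x. f y < f x})"
    using compactE_image[OF K(1), of K "\<lambda>y. {x. f y < f x}"]
      open_superlevel_lower_semicontinuous[OF f] by blast
  then have "D \<noteq> {}"
    using K(2) by auto
  then obtain y where y: "y \<in> D" "\<And>z. z \<in> D \<Longrightarrow> f y \<le> f z"
    using ex_is_arg_min_if_finite[OF D(2), of f] by (auto simp: is_arg_min_linorder)
  \<comment> \<open>The point \<open>y\<close> with least value in \<open>D\<close> also lies in
    \<open>K\<close>, so it is itself covered by the set of some \<open>z\<close> in
    \<open>D\<close>.\<close>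
  obtain z where "z \<in> D" "f z < f y"
    using D(1,3) y(1) by blast
  then show False
    using y(2) by (auto simp: not_less[symmetric])
qed

lemma weak_ekeland:
  fixes h :: "'a::heine_borel \<Rightarrow> real"
  assumes h: "lower_semicontinuous h" "\<And>x. 0 \<le> h x"
    and S: "closed S" "S \<noteq> {}" and "0 < c"
  obtains z0 where "z0 \<in> S" "\<And>z. z \<in> S \<Longrightarrow> h z0 \<le> h z + c * dist z z0"
proof -
  obtain a where a: "a \<in> S"
    using S(2) by blast
  define \<phi> where "\<phi> x = h x + c * dist x a" for x
  \<comment> \<open>The radius makes the penalty alone exceed \<open>h a\<close>, which equals
    \<open>\<phi> a\<close>, outside the ball. Since \<open>h \<ge> 0\<close>, such points cannot
    beat \<open>a\<close>, and the radius is nonnegative, so \<open>a\<close> is in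
    \<open>K\<close>.\<close>
  define K where "K = S \<inter> cball a (h a / c)"
  have "lower_semicontinuous (\<lambda>x. c * dist x a)"
    by (intro continuous_imp_lower_semicontinuous continuous_intros)
  then have "lower_semicontinuous \<phi>"
    unfolding \<phi>_def by (intro lower_semicontinuous_add h(1))
  moreover have "compact K"
    unfolding K_def using S(1) by (intro closed_Int_compact compact_cball)
  moreover have aK: "a \<in> K"
    using a h(2) \<open>0 < c\<close> by (simp add: K_def)
  ultimately obtain z0 where z0: "z0 \<in> K" "\<And>z. z \<in> K \<Longrightarrow> \<phi> z0 \<le> \<phi> z"
    using lower_semicontinuous_attains_inf[of \<phi> K] by blast
  have min: "\<phi> z0 \<le> \<phi> z" if "z \<in> S" for z
  proof (cases "z \<in> K")
    case False
    then have "h a < c * dist z a"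
      using that \<open>0 < c\<close> by (simp add: K_def field_simps dist_commute)
    then have "\<phi> a \<le> \<phi> z"
      using h(2)[of z] by (simp add: \<phi>_def)
    then show ?thesis
      using z0(2)[OF aK] by linarith
  qed (use z0 in blast)
  have "h z0 \<le> h z + c * dist z z0" if "z \<in> S" for z
  proof -
    \<comment> \<open>Inserted into \<open>\<phi> z0 \<le> \<phi> z\<close>, this bound lets
      \<open>c * dist z0 a\<close> cancel, so that the penalty is centred at \<open>z0\<close>
      instead of \<open>a\<close>.\<close>
    have "c * dist z a \<le> c * (dist z z0 + dist z0 a)"
      using \<open>0 < c\<close> by (intro mult_left_mono dist_triangle) auto
    then show ?thesis
      using min[OF that] by (simp add: \<phi>_def algebra_simps)
  qed
  moreover have "z0 \<in> S"
    using z0(1) by (simp add: K_def)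
  ultimately show ?thesis
    using that by blast
qed

text \<open>An intersection of closed sublevel sets; for \<open>p = 0\<close> it is the whole
  space.\<close>

lemma closed_feasible_set:
  assumes "\<And>j. j \<in> {1..p} \<Longrightarrow> lower_semicontinuous (g j)"
  shows "closed (feasible_set p g)"
proof -
  have "feasible_set p g = (\<Inter>j\<in>{1..p}. {u. g j u \<le> 0})"
    by (auto simp: feasible_set_def)
  then show ?thesis
    using assms by (auto intro!: closed_INT closed_sublevel_lower_semicontinuous)
qed

lemma half_width_nonneg: "0 \<le> half_width Q"
  by (simp add: half_width_def)

lemma half_width_add: "half_width (Q + R) = half_width Q + half_width R"
  by (simp add: half_width_def field_simps)

text \<open>The sign condition matters: for negative \<open>r\<close> the lower endpoint is
  \<open>min 0 r = r\<close>, and the interval degenerates to a point.\<close>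

lemma half_width_Ivl_0: "0 \<le> r \<Longrightarrow> half_width (Ivl 0 r) = r / 2"
  unfolding half_width_def including interval.lifting by transfer (simp add: min_def)

theorem theorem3p2:
  fixes F :: "'m::finite \<Rightarrow> real ^ 'n \<Rightarrow> real interval"
    and g :: "nat \<Rightarrow> real ^ 'n \<Rightarrow> real"
    and p :: nat
    and \<epsilon> :: "real ^ 'm"
  assumes F_lsc: "\<And>k. cw_lsc (F k)"
    and g_lsc: "\<And>j. j \<in> {1..p} \<Longrightarrow> lower_semicontinuous (g j)"
    and feasible: "feasible_set p g \<noteq> {}"
    and eps_nonneg: "\<And>k. 0 \<le> \<epsilon> $ k"
    and eps_nonzero: "\<epsilon> \<noteq> 0"
  shows "QM F (feasible_set p g) (\<chi> k. sqrt (\<epsilon> $ k)) \<noteq> {}"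
proof -
  obtain k where "\<epsilon> $ k \<noteq> 0"
    using eps_nonzero by (auto simp: vec_eq_iff)
  \<comment> \<open>The factor 1/2 matches the half-width of \<open>Ivl 0 r\<close>, which is
    \<open>r / 2\<close>.\<close>
  then have c: "0 < sqrt (\<epsilon> $ k) / 2"
    using eps_nonneg[of k] by simp
  have lsc: "lower_semicontinuous (\<lambda>x. half_width (F k x))"
    using F_lsc by (simp add: cw_lsc_def)
  obtain z0 where z0: "z0 \<in> feasible_set p g"
    "\<And>z. z \<in> feasible_set p g \<Longrightarrow>
      half_width (F k z0) \<le> half_width (F k z) + sqrt (\<epsilon> $ k) / 2 * dist z z0"
    using weak_ekeland[OF lsc half_width_nonneg closed_feasible_set[OF g_lsc] feasible c] by blast
  \<comment> \<open>The order demands strict decrease of both center and half-width, in every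
    component at once. Failure of the half-width inequality in the single component \<open>k\<close>
    therefore rules out every feasible \<open>z\<close>.\<close>
  have "\<not> F k z + Ivl 0 (sqrt (\<epsilon> $ k) * norm (z - z0)) \<prec>\<^bsub>CW\<^esub> F k z0"
    if "z \<in> feasible_set p g" for z
    using z0(2)[OF that] c
    by (simp add: cw_less_def half_width_add half_width_Ivl_0 dist_norm not_less)
  then have "z0 \<in> QM F (feasible_set p g) (\<chi> k. sqrt (\<epsilon> $ k))"
    using z0(1) by (auto simp: QM_def)
  then show ?thesis
    by blast
qed

end
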